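(* Let $\Lambda$ be a $k$-graph with $p$ connected components, where $p\in\{1,2,\dots\}\cup\{\infty\}$. Then $H_0(\Lambda)\cong\mathbb{Z}^p$ (where $\mathbb{Z}^\infty$ denotes the direct sum of countably infinitely many copies of $\mathbb{Z}$). In particular, $\Lambda$ is connected if and only if $H_0(\Lambda)\cong\mathbb{Z}$.
   Context: Conventions: $0\in\mathbb{N}$ and $\mathbb{N}^0=\{0\}$. A $k$-graph ($k\ge0$) is a nonempty countable small category $\Lambda$ with a functor $d:\Lambda\to\mathbb{N}^k$ (the degree) satisfying the factorisation property: whenever $d(\lambda)=m+n$ there are unique $\mu,\nu\in\Lambda$ with $d(\mu)=m$, $d(\nu)=n$, $\lambda=\mu\nu$. Objects are identified with identity morphisms; $\Lambda^n=d^{-1}(n)$, so $\Lambda^0$ is the set of vertices; $r,s:\Lambda\to\Lambda^0$ are the codomain and domain maps, and $\mu\nu$ is defined when $s(\mu)=r(\nu)$. $e_1,\dots,e_k$ are the standard generators of $\mathbb{N}^k$, $\mathbf{1}_k=\sum_i e_i$, $\le$ on $\mathbb{N}^k$ is coordinatewise, $|n|=\sum_i n_i$. Let $\approx$ be the equivalence relation on $\Lambda^0$ generated by $\{(r(\lambda),s(\lambda)):\lambda\in\Lambda\}$. $\Lambda$ is connected if $\approx$ is all of $\Lambda^0\times\Lambda^0$. For each $\approx$-class $X\subseteq\Lambda^0$, the $k$-graph $X\Lambda X=\{\lambda\in\Lambda: r(\lambda),s(\lambda)\in X\}$ is a connected component of $\Lambda$; $\Lambda$ is the disjoint union of its connected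 components. Homology: $Q_r(\Lambda)=\{\lambda\in\Lambda: d(\lambda)\le\mathbf{1}_k,\ |d(\lambda)|=r\}$. For $\lambda\in Q_r(\Lambda)$ with $d(\lambda)=e_{i_1}+\dots+e_{i_r}$, $i_1<\dots<i_r$, and $1\le j\le r$, the faces $F_j^0(\lambda),F_j^1(\lambda)\in Q_{r-1}(\Lambda)$ are the unique elements for which there are $\alpha,\beta\in\Lambda^{e_{i_j}}$ with $F_j^0(\lambda)\beta=\lambda=\alpha F_j^1(\lambda)$. $C_r(\Lambda)=\mathbb{Z}Q_r(\Lambda)$ is the free abelian group on $Q_r(\Lambda)$; for $r\ge1$, $\partial_r:C_r(\Lambda)\to C_{r-1}(\Lambda)$ is the homomorphism with $\partial_r(\lambda)=\sum_{\ell=0}^1\sum_{i=1}^r(-1)^{i+\ell}F_i^\ell(\lambda)$, and $\partial_0=0$. This is a chain complex and $H_r(\Lambda)=\ker\partial_r/\operatorname{Im}\partial_{r+1}$. *)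

theory Defs
  imports
    "HOL-Algebra.Free_Abelian_Groups"
    "HOL-Library.Function_Algebras"
    "HOL-Library.Countable_Set"
    "HOL-Library.Extended_Nat"
begin

section \<open>The monoid \<open>\<nat>\<^sup>k\<close>\<close>

text \<open>
  Elements of \<open>\<nat>\<^sup>k\<close> are functions \<^typ>\<open>nat \<Rightarrow> nat\<close> vanishing outside \<open>{1..k}\<close>, so that \<open>k = 0\<close> is
  allowed. Addition and zero are pointwise (\<^theory>\<open>HOL-Library.Function_Algebras\<close>), and so is the
  order \<open>\<le>\<close> of the function type.
\<close>

definition Nk :: "nat \<Rightarrow> (nat \<Rightarrow> nat) set"
  where "Nk k = {n. \<forall>i. i \<notin> {1..k} \<longrightarrow> n i = 0}"

definition gen :: "nat \<Rightarrow> nat \<Rightarrow> nat"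
  where "gen i = (\<lambda>j. if j = i then 1 else 0)"

definition all_ones :: "nat \<Rightarrow> nat \<Rightarrow> nat"
  where "all_ones k = (\<Sum>i = 1..k. gen i)"

definition total :: "nat \<Rightarrow> (nat \<Rightarrow> nat) \<Rightarrow> nat"
  where "total k n = (\<Sum>i = 1..k. n i)"


section \<open>\<open>k\<close>-graphs\<close>

text \<open>
  Objects are identified with their identity morphisms, so \<open>rng\<close> (codomain) and \<open>src\<close> (domain) take
  values in the set \<open>mor\<close> of morphisms. The value of \<open>cmp \<mu> \<nu>\<close> is relevant only if
  \<open>src \<mu> = rng \<nu>\<close>.
\<close>

record 'a graded_cat =
  mor :: "'a set"
  rng :: "'a \<Rightarrow> 'a"
  src :: "'a \<Rightarrow> 'a"
  cmp :: "'a \<Rightarrow> 'a \<Rightarrow> 'a"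
  deg :: "'a \<Rightarrow> nat \<Rightarrow> nat"

locale k_graph =
  fixes k :: nat and \<Lambda> :: "'a graded_cat"
  assumes nonempty: "mor \<Lambda> \<noteq> {}"
    and countable: "countable (mor \<Lambda>)"
    and rng_closed: "\<xi> \<in> mor \<Lambda> \<Longrightarrow> rng \<Lambda> \<xi> \<in> mor \<Lambda>"
    and src_closed: "\<xi> \<in> mor \<Lambda> \<Longrightarrow> src \<Lambda> \<xi> \<in> mor \<Lambda>"
    and rng_rng: "\<xi> \<in> mor \<Lambda> \<Longrightarrow> rng \<Lambda> (rng \<Lambda> \<xi>) = rng \<Lambda> \<xi>"
    and src_rng: "\<xi> \<in> mor \<Lambda> \<Longrightarrow> src \<Lambda> (rng \<Lambda> \<xi>) = rng \<Lambda> \<xi>"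
    and rng_src: "\<xi> \<in> mor \<Lambda> \<Longrightarrow> rng \<Lambda> (src \<Lambda> \<xi>) = src \<Lambda> \<xi>"
    and src_src: "\<xi> \<in> mor \<Lambda> \<Longrightarrow> src \<Lambda> (src \<Lambda> \<xi>) = src \<Lambda> \<xi>"
    and cmp_closed: "\<lbrakk>\<mu> \<in> mor \<Lambda>; \<nu> \<in> mor \<Lambda>; src \<Lambda> \<mu> = rng \<Lambda> \<nu>\<rbrakk> \<Longrightarrow> cmp \<Lambda> \<mu> \<nu> \<in> mor \<Lambda>"
    and rng_cmp: "\<lbrakk>\<mu> \<in> mor \<Lambda>; \<nu> \<in> mor \<Lambda>; src \<Lambda> \<mu> = rng \<Lambda> \<nu>\<rbrakk> \<Longrightarrow> rng \<Lambda> (cmp \<Lambda> \<mu> \<nu>) = rng \<Lambda> \<mu>"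
    and src_cmp: "\<lbrakk>\<mu> \<in> mor \<Lambda>; \<nu> \<in> mor \<Lambda>; src \<Lambda> \<mu> = rng \<Lambda> \<nu>\<rbrakk> \<Longrightarrow> src \<Lambda> (cmp \<Lambda> \<mu> \<nu>) = src \<Lambda> \<nu>"
    and cmp_assoc: "\<lbrakk>\<xi> \<in> mor \<Lambda>; \<mu> \<in> mor \<Lambda>; \<nu> \<in> mor \<Lambda>; src \<Lambda> \<xi> = rng \<Lambda> \<mu>; src \<Lambda> \<mu> = rng \<Lambda> \<nu>\<rbrakk>
      \<Longrightarrow> cmp \<Lambda> (cmp \<Lambda> \<xi> \<mu>) \<nu> = cmp \<Lambda> \<xi> (cmp \<Lambda> \<mu> \<nu>)"
    and cmp_rng: "\<xi> \<in> mor \<Lambda> \<Longrightarrow> cmp \<Lambda> (rng \<Lambda> \<xi>) \<xi> = \<xi>"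
    and cmp_src: "\<xi> \<in> mor \<Lambda> \<Longrightarrow> cmp \<Lambda> \<xi> (src \<Lambda> \<xi>) = \<xi>"
    and deg_closed: "\<xi> \<in> mor \<Lambda> \<Longrightarrow> deg \<Lambda> \<xi> \<in> Nk k"
    and deg_id: "\<xi> \<in> mor \<Lambda> \<Longrightarrow> deg \<Lambda> (rng \<Lambda> \<xi>) = 0"
    and deg_cmp: "\<lbrakk>\<mu> \<in> mor \<Lambda>; \<nu> \<in> mor \<Lambda>; src \<Lambda> \<mu> = rng \<Lambda> \<nu>\<rbrakk>
      \<Longrightarrow> deg \<Lambda> (cmp \<Lambda> \<mu> \<nu>) = deg \<Lambda> \<mu> + deg \<Lambda> \<nu>"
    and factorisation: "\<lbrakk>\<xi> \<in> mor \<Lambda>; m \<in> Nk k; n \<in> Nk k; deg \<Lambda> \<xi> = m + n\<rbrakk>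
      \<Longrightarrow> \<exists>!(\<mu>, \<nu>). \<mu> \<in> mor \<Lambda> \<and> \<nu> \<in> mor \<Lambda> \<and> deg \<Lambda> \<mu> = m \<and> deg \<Lambda> \<nu> = n
            \<and> src \<Lambda> \<mu> = rng \<Lambda> \<nu> \<and> \<xi> = cmp \<Lambda> \<mu> \<nu>"

definition of_degree :: "'a graded_cat \<Rightarrow> (nat \<Rightarrow> nat) \<Rightarrow> 'a set"
  where "of_degree \<Lambda> n = {\<xi> \<in> mor \<Lambda>. deg \<Lambda> \<xi> = n}"

abbreviation vertices :: "'a graded_cat \<Rightarrow> 'a set"
  where "vertices \<Lambda> \<equiv> of_degree \<Lambda> 0"


section \<open>Connected components\<close>

definition conn_rel :: "'a graded_cat \<Rightarrow> ('a \<times> 'a) set"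
  where "conn_rel \<Lambda> =
    \<Inter>{R. equiv (vertices \<Lambda>) R \<and> {(rng \<Lambda> \<xi>, src \<Lambda> \<xi>) | \<xi>. \<xi> \<in> mor \<Lambda>} \<subseteq> R}"

definition connected_kgraph :: "'a graded_cat \<Rightarrow> bool"
  where "connected_kgraph \<Lambda> \<longleftrightarrow> conn_rel \<Lambda> = vertices \<Lambda> \<times> vertices \<Lambda>"

definition full_sub :: "'a graded_cat \<Rightarrow> 'a set \<Rightarrow> 'a graded_cat"
  where "full_sub \<Lambda> X = \<Lambda>\<lparr>mor := {\<xi> \<in> mor \<Lambda>. rng \<Lambda> \<xi> \<in> X \<and> src \<Lambda> \<xi> \<in> X}\<rparr>"

definition components_of_kgraph :: "'a graded_cat \<Rightarrow> 'a graded_cat set"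
  where "components_of_kgraph \<Lambda> = {full_sub \<Lambda> X | X. X \<in> vertices \<Lambda> // conn_rel \<Lambda>}"

definition num_components :: "'a graded_cat \<Rightarrow> enat"
  where "num_components \<Lambda> =
    (if finite (components_of_kgraph \<Lambda>) then enat (card (components_of_kgraph \<Lambda>)) else \<infinity>)"


section \<open>Cubical homology\<close>

definition cubes :: "nat \<Rightarrow> 'a graded_cat \<Rightarrow> nat \<Rightarrow> 'a set"
  where "cubes k \<Lambda> r = {\<xi> \<in> mor \<Lambda>. deg \<Lambda> \<xi> \<le> all_ones k \<and> total k (deg \<Lambda> \<xi>) = r}"

text \<open>If \<open>deg \<Lambda> \<xi> = e\<^bsub>i\<^sub>1\<^esub> + \<dots> + e\<^bsub>i\<^sub>r\<^esub>\<close> with \<open>i\<^sub>1 < \<dots> < i\<^sub>r\<close>, then \<open>direction \<Lambda> \<xi> j = i\<^sub>j\<close>, for \<open>1 \<le> j \<le> r\<close>.\<close>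

definition direction :: "'a graded_cat \<Rightarrow> 'a \<Rightarrow> nat \<Rightarrow> nat"
  where "direction \<Lambda> \<xi> j = sorted_list_of_set {i. deg \<Lambda> \<xi> i \<noteq> 0} ! (j - 1)"

definition face0 :: "nat \<Rightarrow> 'a graded_cat \<Rightarrow> nat \<Rightarrow> nat \<Rightarrow> 'a \<Rightarrow> 'a"
  where "face0 k \<Lambda> r j \<xi> = (THE \<mu>. \<mu> \<in> cubes k \<Lambda> (r - 1) \<and>
    (\<exists>\<beta> \<in> of_degree \<Lambda> (gen (direction \<Lambda> \<xi> j)). src \<Lambda> \<mu> = rng \<Lambda> \<beta> \<and> cmp \<Lambda> \<mu> \<beta> = \<xi>))"

definition face1 :: "nat \<Rightarrow> 'a graded_cat \<Rightarrow> nat \<Rightarrow> nat \<Rightarrow> 'a \<Rightarrow> 'a"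
  where "face1 k \<Lambda> r j \<xi> = (THE \<nu>. \<nu> \<in> cubes k \<Lambda> (r - 1) \<and>
    (\<exists>\<alpha> \<in> of_degree \<Lambda> (gen (direction \<Lambda> \<xi> j)). src \<Lambda> \<alpha> = rng \<Lambda> \<nu> \<and> \<xi> = cmp \<Lambda> \<alpha> \<nu>))"

definition face :: "nat \<Rightarrow> 'a graded_cat \<Rightarrow> nat \<Rightarrow> nat \<Rightarrow> nat \<Rightarrow> 'a \<Rightarrow> 'a"
  where "face k \<Lambda> r l j \<xi> = (if l = 0 then face0 k \<Lambda> r j \<xi> else face1 k \<Lambda> r j \<xi>)"

definition chains :: "nat \<Rightarrow> 'a graded_cat \<Rightarrow> nat \<Rightarrow> ('a \<Rightarrow>\<^sub>0 int) monoid"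
  where "chains k \<Lambda> r = free_Abelian_group (cubes k \<Lambda> r)"

text \<open>
  \<^const>\<open>frag_extend\<close> extends a map on generators linearly. For \<open>r = 0\<close> the sum over \<open>{1..0}\<close> is
  empty, so \<open>bdry k \<Lambda> 0 = 0\<close>.
\<close>

definition bdry :: "nat \<Rightarrow> 'a graded_cat \<Rightarrow> nat \<Rightarrow> ('a \<Rightarrow>\<^sub>0 int) \<Rightarrow> ('a \<Rightarrow>\<^sub>0 int)"
  where "bdry k \<Lambda> r = frag_extend
    (\<lambda>\<xi>. \<Sum>l = 0..1. \<Sum>i = 1..r. frag_cmul ((- 1) ^ (i + l)) (frag_of (face k \<Lambda> r l i \<xi>)))"

text \<open>
  For \<open>r = 0\<close> the formal codomain \<open>chains k \<Lambda> (r - 1)\<close> is \<open>chains k \<Lambda> 0\<close>; as \<open>bdry k \<Lambda> 0 = 0\<close>, the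
  kernel is all of \<open>chains k \<Lambda> 0\<close>, as it should be.
\<close>

definition homology :: "nat \<Rightarrow> 'a graded_cat \<Rightarrow> nat \<Rightarrow> ('a \<Rightarrow>\<^sub>0 int) set monoid"
  where "homology k \<Lambda> r =
    subgroup_generated (chains k \<Lambda> r) (kernel (chains k \<Lambda> r) (chains k \<Lambda> (r - 1)) (bdry k \<Lambda> r))
      Mod (bdry k \<Lambda> (r + 1) ` carrier (chains k \<Lambda> (r + 1)))"


section \<open>The groups \<open>\<int>\<^sup>p\<close>\<close>

text \<open>\<^const>\<open>sum_group\<close> is the direct sum; for \<open>p = \<infinity>\<close> the index set is all of \<^typ>\<open>nat\<close>.\<close>

definition Zpow :: "enat \<Rightarrow> (nat \<Rightarrow> int) monoid"
  where "Zpow p = sum_group {i. enat i < p} (\<lambda>_. integer_group)"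

end

theory Submission
  imports Defs
begin

text \<open>
  The group of \<open>0\<close>-chains is free on the vertices, \<open>\<partial>\<^sub>0 = 0\<close>, and an edge \<open>\<xi>\<close> has
  boundary \<open>s(\<xi>) - r(\<xi>)\<close>. Hence \<open>H\<^sub>0\<close> is the free abelian group on the vertices with the two ends of
  every edge identified. Every path factors into edges, so identifying the ends of edges identifies
  the ends of all paths, which is exactly \<open>\<approx>\<close> (\<open>conn_rel_subset_edge_equiv\<close>).
  Passing from the vertices to their \<open>\<approx>\<close>-classes therefore kills exactly the boundaries
  (\<open>free_Abelian_group_Mod_equiv\<close>), and \<open>H\<^sub>0\<close> is free abelian on the set of classes.

  Classes correspond bijectively to connected components, and as there are only countably many,
  their number \<open>p\<close> determines them up to bijection; this gives \<open>\<int>\<^sup>p\<close>. Finally the rank of a free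
  abelian group is an isomorphism invariant, so the group is \<open>\<int>\<close> only if there is exactly one class.
\<close>

section \<open>Quotients of free abelian groups\<close>

text \<open>
  The map induced by \<open>V \<rightarrow> V // R\<close> is onto, and it remains to see that its kernel lies in \<open>N\<close>.
  Choosing a representative in each class gives a section; as \<open>N\<close> contains the difference of any
  element of \<open>V\<close> and its representative, applying the projection and then the section changes an element
  of the free group only by an element of \<open>N\<close>, so whatever projects to \<open>0\<close> lies in \<open>N\<close>.
\<close>

lemma free_Abelian_group_Mod_equiv:
  fixes V :: "'a set"
  assumes R: "equiv V R"
    and N: "N \<subseteq> carrier (free_Abelian_group V)"
    and zero: "0 \<in> N"
    and diff: "\<And>a b. a \<in> N \<Longrightarrow> b \<in> N \<Longrightarrow> a - b \<in> N"
    and rel: "\<And>u v. (u, v) \<in> R \<Longrightarrow> frag_of u - frag_of v \<in> N"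
    and kills: "\<And>c. c \<in> N \<Longrightarrow> frag_extend (\<lambda>v. frag_of (R `` {v})) c = 0"
  shows "group (free_Abelian_group V Mod N)"
    and "free_Abelian_group V Mod N \<cong> free_Abelian_group (V // R)"
proof -
  let ?G = "free_Abelian_group V" and ?H = "free_Abelian_group (V // R)"
  define pr where "pr = frag_extend (\<lambda>v. frag_of (R `` {v}))"
  define sec where "sec = frag_extend (\<lambda>X. frag_of (SOME v. v \<in> X) :: 'a \<Rightarrow>\<^sub>0 int)"
  have rep: "(v, SOME u. u \<in> R `` {v}) \<in> R" if "v \<in> V" for v
  proof -
    have "v \<in> R `` {v}" using equiv_class_self[OF R that] .
    then have "(SOME u. u \<in> R `` {v}) \<in> R `` {v}" by (rule someI)
    then show ?thesis by simp
  qed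
  have in_H: "Poly_Mapping.keys (pr c) \<subseteq> V // R" if "Poly_Mapping.keys c \<subseteq> V" for c
    using keys_frag_extend[of "\<lambda>v. frag_of (R `` {v})" c] that
    by (fastforce simp: pr_def quotient_def)
  have hom: "group_hom ?G ?H pr"
    unfolding group_hom_def group_hom_axioms_def hom_def
    using in_H by (auto simp: pr_def frag_extend_add)
  have onto: "pr ` carrier ?G = carrier ?H"
  proof (intro equalityI subsetI)
    fix y assume "y \<in> carrier ?H"
    then have "Poly_Mapping.keys y \<subseteq> V // R" by simp
    then show "y \<in> pr ` carrier ?G"
    proof (induction y rule: frag_induction)
      case zero
      show ?case by (rule image_eqI[of _ _ 0]) (auto simp: pr_def)
    next
      case (one X)
      then obtain v where "v \<in> V" "X = R `` {v}" by (auto elim: quotientE)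
      then show ?case by (intro image_eqI[of _ _ "frag_of v"]) (auto simp: pr_def)
    next
      case (diff a b)
      then obtain a' b' where *: "Poly_Mapping.keys a' \<subseteq> V" "a = pr a'"
          "Poly_Mapping.keys b' \<subseteq> V" "b = pr b'"
        by auto
      moreover have "Poly_Mapping.keys (a' - b') \<subseteq> V"
        using * keys_diff[of a' b'] by blast
      ultimately show ?case
        by (intro image_eqI[of _ _ "a' - b'"]) (auto simp: pr_def frag_extend_diff)
    qed
  qed (use in_H in \<open>auto dest: subsetD[OF in_H]\<close>)
  have section_mod_N: "c - sec (pr c) \<in> N" if "Poly_Mapping.keys c \<subseteq> V" for c
    using that
  proof (induction c rule: frag_induction)
    case zero
    show ?case using \<open>0 \<in> N\<close> by (simp add: pr_def sec_def)
  next
    case (one v)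
    then show ?case using rel[OF rep] by (simp add: pr_def sec_def)
  next
    case (diff a b)
    have "a - b - sec (pr (a - b)) = (a - sec (pr a)) - (b - sec (pr b))"
      by (simp add: pr_def sec_def frag_extend_diff)
    then show ?case using assms(4)[OF diff(1,2)] by (simp only:)
  qed
  have "kernel ?G ?H pr = N"
  proof (intro equalityI subsetI)
    fix c assume "c \<in> kernel ?G ?H pr"
    then show "c \<in> N" using section_mod_N[of c] by (simp add: kernel_def sec_def)
  next
    fix c assume "c \<in> N"
    then show "c \<in> kernel ?G ?H pr" using subsetD[OF N] kills by (simp add: kernel_def pr_def)
  qed
  then show "group (?G Mod N)" "?G Mod N \<cong> ?H"
    using normal.factorgroup_is_group[OF group_hom.normal_kernel[OF hom]]
      group_hom.FactGroup_iso[OF hom onto] by simp_all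
qed

section \<open>Low-dimensional cubes\<close>

lemma gen_in_Nk: "i \<in> {1..k} \<Longrightarrow> gen i \<in> Nk k"
  by (auto simp: Nk_def gen_def)

lemma all_ones_apply: "all_ones k j = (if j \<in> {1..k} then 1 else 0)"
proof -
  have "(\<Sum>i\<in>A. gen i) j = (\<Sum>i\<in>A. gen i j)" if "finite A" for A :: "nat set"
    using that by (induction A rule: finite_induct) auto
  then show ?thesis by (simp add: all_ones_def gen_def)
qed

lemma total_eq_0: "n \<in> Nk k \<Longrightarrow> total k n = 0 \<Longrightarrow> n = 0"
  by (auto simp: total_def Nk_def fun_eq_iff)

lemma total_gen: "i \<in> {1..k} \<Longrightarrow> total k (gen i) = 1"
  by (simp add: total_def gen_def)

lemma gen_le_all_ones: "i \<in> {1..k} \<Longrightarrow> gen i \<le> all_ones k"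
  by (auto simp: le_fun_def all_ones_apply gen_def)

lemma total_pos_split:
  assumes "n \<in> Nk k" "n \<noteq> 0"
  obtains i m where "i \<in> {1..k}" "m \<in> Nk k" "n = gen i + m" "total k m < total k n"
proof -
  obtain i where i: "n i \<noteq> 0" using assms(2) by (auto simp: fun_eq_iff)
  then have ik: "i \<in> {1..k}" using assms(1) by (auto simp: Nk_def)
  let ?m = "n(i := n i - 1)"
  have eq: "n = gen i + ?m" using i by (auto simp: fun_eq_iff gen_def)
  have "?m \<in> Nk k" using assms(1) ik by (auto simp: Nk_def)
  moreover have "total k ?m < total k n"
    unfolding total_def by (rule sum_strict_mono_ex1) (use i ik in auto)
  ultimately show thesis using that eq ik by blast
qed

lemma total_eq_1:
  assumes "n \<in> Nk k" "total k n = 1"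
  obtains i where "i \<in> {1..k}" "n = gen i"
proof -
  have "n \<noteq> 0" using assms(2) by (auto simp: total_def)
  then obtain i m where im: "i \<in> {1..k}" "m \<in> Nk k" "n = gen i + m" "total k m < total k n"
    using total_pos_split[OF assms(1)] by blast
  have "m = 0" by (rule total_eq_0[OF im(2)]) (use im(4) assms(2) in simp)
  with im that show thesis by simp
qed

context k_graph
begin

lemma rng_vertex: "\<xi> \<in> mor \<Lambda> \<Longrightarrow> rng \<Lambda> \<xi> \<in> vertices \<Lambda>"
  by (simp add: of_degree_def rng_closed deg_id)

lemma src_vertex: "\<xi> \<in> mor \<Lambda> \<Longrightarrow> src \<Lambda> \<xi> \<in> vertices \<Lambda>"
  using rng_vertex[OF src_closed] by (simp add: rng_src)

text \<open>
  A morphism \<open>v\<close> of degree \<open>0\<close> factors as \<open>r(v) v\<close> and as \<open>v s(v)\<close>, both with factors of degree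
  \<open>0\<close>; uniqueness of factorisations makes \<open>v\<close> an identity.
\<close>

lemma vertex_identity:
  assumes "v \<in> vertices \<Lambda>"
  shows "rng \<Lambda> v = v" "src \<Lambda> v = v"
proof -
  have v: "v \<in> mor \<Lambda>" "deg \<Lambda> v = 0" using assms by (auto simp: of_degree_def)
  have z: "0 \<in> Nk k" by (simp add: Nk_def)
  have "\<exists>!(\<mu>, \<nu>). \<mu> \<in> mor \<Lambda> \<and> \<nu> \<in> mor \<Lambda> \<and> deg \<Lambda> \<mu> = 0 \<and> deg \<Lambda> \<nu> = 0
            \<and> src \<Lambda> \<mu> = rng \<Lambda> \<nu> \<and> v = cmp \<Lambda> \<mu> \<nu>" (is "\<exists>!x. ?P x")
    using factorisation[OF v(1) z z] v(2) by simp
  moreover have "?P (rng \<Lambda> v, v)"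
    using v by (simp add: rng_closed deg_id src_rng cmp_rng)
  moreover have "?P (v, src \<Lambda> v)"
    using v src_vertex[OF v(1)] by (simp add: src_closed of_degree_def rng_src cmp_src)
  ultimately have "(rng \<Lambda> v, v) = (v, src \<Lambda> v)" by blast
  then show "rng \<Lambda> v = v" "src \<Lambda> v = v" by auto
qed

lemma cubes_0: "cubes k \<Lambda> 0 = vertices \<Lambda>"
  using total_eq_0[OF deg_closed]
  by (auto simp: cubes_def of_degree_def total_def le_fun_def)

lemma cubes_1: "cubes k \<Lambda> 1 = (\<Union>i\<in>{1..k}. of_degree \<Lambda> (gen i))"
proof (intro equalityI subsetI)
  fix \<xi> assume "\<xi> \<in> cubes k \<Lambda> 1"
  then have "\<xi> \<in> mor \<Lambda>" "total k (deg \<Lambda> \<xi>) = 1" by (auto simp: cubes_def)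
  moreover from this obtain i where "i \<in> {1..k}" "deg \<Lambda> \<xi> = gen i"
    using total_eq_1[OF deg_closed] by blast
  ultimately show "\<xi> \<in> (\<Union>i\<in>{1..k}. of_degree \<Lambda> (gen i))"
    by (auto simp: of_degree_def)
next
  fix \<xi> assume "\<xi> \<in> (\<Union>i\<in>{1..k}. of_degree \<Lambda> (gen i))"
  then show "\<xi> \<in> cubes k \<Lambda> 1"
    using total_gen gen_le_all_ones by (auto simp: cubes_def of_degree_def)
qed

lemma edge_direction:
  assumes "\<xi> \<in> cubes k \<Lambda> 1"
  shows "\<xi> \<in> of_degree \<Lambda> (gen (direction \<Lambda> \<xi> 1))"
proof -
  obtain i where i: "\<xi> \<in> of_degree \<Lambda> (gen i)" using assms cubes_1 by blast
  then have "{j. deg \<Lambda> \<xi> j \<noteq> 0} = {i}" by (auto simp: of_degree_def gen_def)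
  then have "direction \<Lambda> \<xi> 1 = i" by (simp add: direction_def)
  with i show ?thesis by simp
qed

text \<open>
  In a factorisation of an edge whose first or second factor is a vertex, that vertex is an identity
  and the other factor is the edge itself.
\<close>

lemma face0_edge:
  assumes "\<xi> \<in> cubes k \<Lambda> 1"
  shows "face0 k \<Lambda> 1 1 \<xi> = rng \<Lambda> \<xi>"
proof -
  have mor: "\<xi> \<in> mor \<Lambda>" using assms by (simp add: cubes_def)
  show ?thesis
    unfolding face0_def diff_self_eq_0 cubes_0
  proof (rule the_equality)
    show "rng \<Lambda> \<xi> \<in> vertices \<Lambda> \<and> (\<exists>\<beta>\<in>of_degree \<Lambda> (gen (direction \<Lambda> \<xi> 1)).
        src \<Lambda> (rng \<Lambda> \<xi>) = rng \<Lambda> \<beta> \<and> cmp \<Lambda> (rng \<Lambda> \<xi>) \<beta> = \<xi>)"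
      using mor edge_direction[OF assms] by (auto simp: rng_vertex src_rng cmp_rng)
  next
    fix \<mu> assume "\<mu> \<in> vertices \<Lambda> \<and> (\<exists>\<beta>\<in>of_degree \<Lambda> (gen (direction \<Lambda> \<xi> 1)).
        src \<Lambda> \<mu> = rng \<Lambda> \<beta> \<and> cmp \<Lambda> \<mu> \<beta> = \<xi>)"
    then obtain \<beta> where "\<mu> \<in> vertices \<Lambda>" "\<beta> \<in> mor \<Lambda>" "src \<Lambda> \<mu> = rng \<Lambda> \<beta>" "cmp \<Lambda> \<mu> \<beta> = \<xi>"
      by (auto simp: of_degree_def)
    then show "\<mu> = rng \<Lambda> \<xi>" by (metis vertex_identity(2) cmp_rng)
  qed
qed

lemma face1_edge:
  assumes "\<xi> \<in> cubes k \<Lambda> 1"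
  shows "face1 k \<Lambda> 1 1 \<xi> = src \<Lambda> \<xi>"
proof -
  have mor: "\<xi> \<in> mor \<Lambda>" using assms by (simp add: cubes_def)
  show ?thesis
    unfolding face1_def diff_self_eq_0 cubes_0
  proof (rule the_equality)
    show "src \<Lambda> \<xi> \<in> vertices \<Lambda> \<and> (\<exists>\<alpha>\<in>of_degree \<Lambda> (gen (direction \<Lambda> \<xi> 1)).
        src \<Lambda> \<alpha> = rng \<Lambda> (src \<Lambda> \<xi>) \<and> \<xi> = cmp \<Lambda> \<alpha> (src \<Lambda> \<xi>))"
      using mor edge_direction[OF assms] by (auto simp: src_vertex rng_src cmp_src)
  next
    fix \<nu> assume "\<nu> \<in> vertices \<Lambda> \<and> (\<exists>\<alpha>\<in>of_degree \<Lambda> (gen (direction \<Lambda> \<xi> 1)).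
        src \<Lambda> \<alpha> = rng \<Lambda> \<nu> \<and> \<xi> = cmp \<Lambda> \<alpha> \<nu>)"
    then obtain \<alpha> where "\<nu> \<in> vertices \<Lambda>" "\<alpha> \<in> mor \<Lambda>" "src \<Lambda> \<alpha> = rng \<Lambda> \<nu>" "\<xi> = cmp \<Lambda> \<alpha> \<nu>"
      by (auto simp: of_degree_def)
    then show "\<nu> = src \<Lambda> \<xi>" by (metis vertex_identity(1) cmp_src)
  qed
qed

lemma bdry_edge:
  assumes "\<xi> \<in> cubes k \<Lambda> 1"
  shows "bdry k \<Lambda> 1 (frag_of \<xi>) = frag_of (src \<Lambda> \<xi>) - frag_of (rng \<Lambda> \<xi>)"
  using face0_edge[OF assms] face1_edge[OF assms]
  by (simp add: bdry_def face_def atLeast0_atMost_Suc)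

section \<open>The connectivity relation\<close>

lemma equiv_conn_rel: "equiv (vertices \<Lambda>) (conn_rel \<Lambda>)"
proof -
  let ?S = "{R. equiv (vertices \<Lambda>) R \<and> {(rng \<Lambda> \<xi>, src \<Lambda> \<xi>) | \<xi>. \<xi> \<in> mor \<Lambda>} \<subseteq> R}"
  have "equiv (vertices \<Lambda>) (vertices \<Lambda> \<times> vertices \<Lambda>)"
    by (auto simp: equiv_def refl_on_def sym_def trans_def)
  then have top: "vertices \<Lambda> \<times> vertices \<Lambda> \<in> ?S"
    using rng_vertex src_vertex by auto
  show ?thesis
  proof (rule equivI)
    show "conn_rel \<Lambda> \<subseteq> vertices \<Lambda> \<times> vertices \<Lambda>"
      unfolding conn_rel_def using top by (rule Inter_lower)
    show "refl_on (vertices \<Lambda>) (conn_rel \<Lambda>)"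
      unfolding conn_rel_def by (auto simp: equiv_def refl_on_def)
    show "sym (conn_rel \<Lambda>)"
      unfolding conn_rel_def by (rule symI) (auto simp: equiv_def dest: symD)
    show "trans (conn_rel \<Lambda>)"
      unfolding conn_rel_def by (rule transI) (blast elim: equivE dest: transD)
  qed
qed

lemma conn_rel_path: "\<xi> \<in> mor \<Lambda> \<Longrightarrow> (rng \<Lambda> \<xi>, src \<Lambda> \<xi>) \<in> conn_rel \<Lambda>"
  unfolding conn_rel_def by auto

text \<open>
  By induction on the total degree, splitting off the first edge of a path, the two ends of every
  path are related as soon as the two ends of every edge are.
\<close>

lemma conn_rel_subset_edge_equiv:
  assumes S: "equiv (vertices \<Lambda>) S"
    and edge: "\<And>\<xi>. \<xi> \<in> cubes k \<Lambda> 1 \<Longrightarrow> (rng \<Lambda> \<xi>, src \<Lambda> \<xi>) \<in> S"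
  shows "conn_rel \<Lambda> \<subseteq> S"
proof -
  have "(rng \<Lambda> \<xi>, src \<Lambda> \<xi>) \<in> S" if "\<xi> \<in> mor \<Lambda>" for \<xi>
    using that
  proof (induction "total k (deg \<Lambda> \<xi>)" arbitrary: \<xi> rule: less_induct)
    case less
    show ?case
    proof (cases "deg \<Lambda> \<xi> = 0")
      case True
      then have "\<xi> \<in> vertices \<Lambda>" using less.prems by (simp add: of_degree_def)
      then show ?thesis
        using S vertex_identity by (simp add: equiv_def refl_on_def)
    next
      case False
      then obtain i m where im: "i \<in> {1..k}" "m \<in> Nk k" "deg \<Lambda> \<xi> = gen i + m"
          "total k m < total k (deg \<Lambda> \<xi>)"
        using total_pos_split[OF deg_closed[OF less.prems]] by metis
      then obtain \<mu> \<nu> where f: "\<mu> \<in> mor \<Lambda>" "\<nu> \<in> mor \<Lambda>" "deg \<Lambda> \<mu> = gen i" "deg \<Lambda> \<nu> = m"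
          "src \<Lambda> \<mu> = rng \<Lambda> \<nu>" "\<xi> = cmp \<Lambda> \<mu> \<nu>"
        using factorisation[OF less.prems gen_in_Nk[OF im(1)] im(2,3)] by auto
      have "\<mu> \<in> cubes k \<Lambda> 1" using f im(1) unfolding cubes_1 by (auto simp: of_degree_def)
      then have "(rng \<Lambda> \<mu>, src \<Lambda> \<mu>) \<in> S" by (rule edge)
      moreover have "(rng \<Lambda> \<nu>, src \<Lambda> \<nu>) \<in> S" using less.hyps[of \<nu>] f im by simp
      ultimately show ?thesis
        using S f by (auto simp: equiv_def rng_cmp src_cmp dest: transD)
    qed
  qed
  with S show ?thesis unfolding conn_rel_def by blast
qed

section \<open>Homology in degree zero\<close>

lemma homology_0:
  "homology k \<Lambda> 0 = free_Abelian_group (vertices \<Lambda>) Mod (bdry k \<Lambda> 1 ` carrier (chains k \<Lambda> 1))"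
proof -
  have "bdry k \<Lambda> 0 c = 0" for c
    unfolding bdry_def by (rule frag_extend_eq_0) simp
  then have "kernel (chains k \<Lambda> 0) (chains k \<Lambda> (0 - 1)) (bdry k \<Lambda> 0) = carrier (chains k \<Lambda> 0)"
    by (auto simp: kernel_def chains_def)
  then show ?thesis
    unfolding homology_def
    by (simp add: chains_def cubes_0 group.subgroup_generated_group_carrier)
qed

text \<open>
  The boundaries play the role of \<open>N\<close> in \<open>free_Abelian_group_Mod_equiv\<close>. They are killed by passing
  to classes because the two ends of an edge lie in the same class. Conversely, the vertices whose
  difference is a boundary form an equivalence relation relating the ends of every edge, so it
  contains \<open>\<approx>\<close>. That \<open>H\<^sub>0\<close> is a group is recorded because inverting an isomorphism starting at
  \<open>H\<^sub>0\<close> requires it.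
\<close>

lemma homology_0_iso_free_on_classes:
  shows "group (homology k \<Lambda> 0)"
    and "homology k \<Lambda> 0 \<cong> free_Abelian_group (vertices \<Lambda> // conn_rel \<Lambda>)"
proof -
  define N where "N = bdry k \<Lambda> 1 ` carrier (chains k \<Lambda> 1)"
  have zero: "0 \<in> N"
    unfolding N_def by (rule image_eqI[of _ _ 0]) (auto simp: bdry_def chains_def)
  have diff: "a - b \<in> N" if ab: "a \<in> N" "b \<in> N" for a b
  proof -
    obtain a' b' where *: "a = bdry k \<Lambda> 1 a'" "b = bdry k \<Lambda> 1 b'"
        "Poly_Mapping.keys a' \<subseteq> cubes k \<Lambda> 1" "Poly_Mapping.keys b' \<subseteq> cubes k \<Lambda> 1"
      using ab by (auto simp: N_def chains_def)
    moreover have "Poly_Mapping.keys (a' - b') \<subseteq> cubes k \<Lambda> 1"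
      using * keys_diff[of a' b'] by blast
    moreover have "a - b = bdry k \<Lambda> 1 (a' - b')"
      using * by (simp add: bdry_def frag_extend_diff)
    ultimately show ?thesis unfolding N_def chains_def by auto
  qed
  have boundary_edge: "frag_of (src \<Lambda> \<xi>) - frag_of (rng \<Lambda> \<xi>) \<in> N" if "\<xi> \<in> cubes k \<Lambda> 1" for \<xi>
    unfolding N_def using that bdry_edge[OF that, symmetric] by (auto simp: chains_def)
  have carrier_kills: "Poly_Mapping.keys c \<subseteq> vertices \<Lambda> \<and>
      frag_extend (\<lambda>v. frag_of (conn_rel \<Lambda> `` {v})) c = 0" if c: "c \<in> N" for c
  proof -
    obtain e where e: "c = bdry k \<Lambda> 1 e" "Poly_Mapping.keys e \<subseteq> cubes k \<Lambda> 1"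
      using c by (auto simp: N_def chains_def)
    show ?thesis unfolding e(1) using e(2)
    proof (induction e rule: frag_induction)
      case zero
      show ?case by (simp add: bdry_def)
    next
      case (one \<xi>)
      then have mor: "\<xi> \<in> mor \<Lambda>" by (simp add: cubes_def)
      have "conn_rel \<Lambda> `` {rng \<Lambda> \<xi>} = conn_rel \<Lambda> `` {src \<Lambda> \<xi>}"
        by (rule equiv_class_eq[OF equiv_conn_rel conn_rel_path[OF mor]])
      moreover have "Poly_Mapping.keys (frag_of (src \<Lambda> \<xi>) - frag_of (rng \<Lambda> \<xi>)) \<subseteq> vertices \<Lambda>"
        using keys_diff[of "frag_of (src \<Lambda> \<xi>)" "frag_of (rng \<Lambda> \<xi>)"]
          rng_vertex[OF mor] src_vertex[OF mor] by auto
      ultimately show ?case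
        unfolding bdry_edge[OF one] by (intro conjI) (simp_all only: frag_extend_diff frag_extend_of diff_self)
    next
      case (diff a b)
      have "bdry k \<Lambda> 1 (a - b) = bdry k \<Lambda> 1 a - bdry k \<Lambda> 1 b"
        by (simp add: bdry_def frag_extend_diff)
      then show ?case
        using diff keys_diff[of "bdry k \<Lambda> 1 a" "bdry k \<Lambda> 1 b"] by (auto simp: frag_extend_diff)
    qed
  qed
  define S where "S = {(u, v) \<in> vertices \<Lambda> \<times> vertices \<Lambda>. frag_of u - frag_of v \<in> N}"
  have uminus: "b - a \<in> N" if "a - b \<in> N" for a b
    using diff[OF zero that] by simp
  have "equiv (vertices \<Lambda>) S"
  proof (rule equivI)
    show "sym S" unfolding S_def by (rule symI) (auto intro: uminus)
    show "trans S"
    proof (rule transI)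
      fix u v w assume *: "(u, v) \<in> S" "(v, w) \<in> S"
      \<comment> \<open>\<open>N\<close> is known to be closed only under differences, so adding \<open>v - w\<close> means subtracting \<open>w - v\<close>.\<close>
      have "(frag_of u - frag_of v) - (frag_of w - frag_of v) \<in> N"
        by (rule diff) (use * uminus in \<open>auto simp: S_def\<close>)
      then show "(u, w) \<in> S" using * by (simp add: S_def)
    qed
  qed (use zero in \<open>auto simp: S_def refl_on_def\<close>)
  moreover have "(rng \<Lambda> \<xi>, src \<Lambda> \<xi>) \<in> S" if "\<xi> \<in> cubes k \<Lambda> 1" for \<xi>
    using uminus[OF boundary_edge[OF that]] that rng_vertex src_vertex
    by (simp add: S_def cubes_def)
  ultimately have sub: "conn_rel \<Lambda> \<subseteq> S" by (rule conn_rel_subset_edge_equiv)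
  have rel: "frag_of u - frag_of v \<in> N" if "(u, v) \<in> conn_rel \<Lambda>" for u v
    using subsetD[OF sub that] by (simp add: S_def)
  have "N \<subseteq> carrier (free_Abelian_group (vertices \<Lambda>))"
    unfolding subset_iff carrier_free_Abelian_group_iff using carrier_kills by blast
  note quotient = free_Abelian_group_Mod_equiv[OF equiv_conn_rel this zero diff rel
      conjunct2[OF carrier_kills]]
  show "group (homology k \<Lambda> 0)"
    and "homology k \<Lambda> 0 \<cong> free_Abelian_group (vertices \<Lambda> // conn_rel \<Lambda>)"
    unfolding homology_0 N_def[symmetric] by (rule quotient; assumption)+
qed

section \<open>Counting components\<close>

lemma components_eqpoll_classes:
  "components_of_kgraph \<Lambda> \<approx> vertices \<Lambda> // conn_rel \<Lambda>"
proof -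
  have sub: "X \<subseteq> vertices \<Lambda>" if "X \<in> vertices \<Lambda> // conn_rel \<Lambda>" for X
    using that Union_quotient[OF equiv_conn_rel] by blast
  \<comment> \<open>A class is recovered from its component as the set of vertices in it.\<close>
  have "X = vertices \<Lambda> \<inter> mor (full_sub \<Lambda> X)" if "X \<in> vertices \<Lambda> // conn_rel \<Lambda>" for X
    using sub[OF that] vertex_identity by (auto simp: full_sub_def of_degree_def)
  then have "inj_on (full_sub \<Lambda>) (vertices \<Lambda> // conn_rel \<Lambda>)"
    by (metis inj_onI)
  moreover have "components_of_kgraph \<Lambda> = full_sub \<Lambda> ` (vertices \<Lambda> // conn_rel \<Lambda>)"
    by (auto simp: components_of_kgraph_def)
  ultimately show ?thesis by (simp add: inj_on_image_eqpoll_self)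
qed

text \<open>
  Here countability of \<open>\<Lambda>\<close> enters: an infinite number of components is countably infinite, so
  that the index set of \<open>\<int>\<^sup>\<infinity>\<close>, which is \<open>\<nat>\<close>, has the right size.
\<close>

lemma classes_eqpoll_index:
  "vertices \<Lambda> // conn_rel \<Lambda> \<approx> {i. enat i < num_components \<Lambda>}"
proof (cases "finite (components_of_kgraph \<Lambda>)")
  case True
  then have "{i. enat i < num_components \<Lambda>} = {..<card (components_of_kgraph \<Lambda>)}"
    by (auto simp: num_components_def)
  moreover have "components_of_kgraph \<Lambda> \<approx> {..<card (components_of_kgraph \<Lambda>)}"
    using True by (simp add: eqpoll_iff_finite_card)
  ultimately show ?thesis
    using components_eqpoll_classes by (metis eqpoll_sym eqpoll_trans)
next
  case False
  then have univ: "{i. enat i < num_components \<Lambda>} = UNIV" by (simp add: num_components_def)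
  have "countable (vertices \<Lambda>)"
    by (rule countable_subset[OF _ countable]) (auto simp: of_degree_def)
  moreover have "vertices \<Lambda> // conn_rel \<Lambda> = (\<lambda>v. conn_rel \<Lambda> `` {v}) ` vertices \<Lambda>"
    by (auto simp: quotient_def)
  ultimately have "countable (vertices \<Lambda> // conn_rel \<Lambda>)" by simp
  moreover have "infinite (vertices \<Lambda> // conn_rel \<Lambda>)"
    using False components_eqpoll_classes eqpoll_finite_iff by blast
  ultimately have "bij_betw (to_nat_on (vertices \<Lambda> // conn_rel \<Lambda>)) (vertices \<Lambda> // conn_rel \<Lambda>) UNIV"
    by (rule to_nat_on_infinite)
  then show ?thesis unfolding univ eqpoll_def by blast
qed

lemma connected_iff_one_class:
  "connected_kgraph \<Lambda> \<longleftrightarrow> (\<exists>X. vertices \<Lambda> // conn_rel \<Lambda> = {X})"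
proof
  obtain \<xi> where "\<xi> \<in> mor \<Lambda>" using nonempty by blast
  then have ne: "rng \<Lambda> \<xi> \<in> vertices \<Lambda>" by (rule rng_vertex)
  assume "connected_kgraph \<Lambda>"
  then have "vertices \<Lambda> // conn_rel \<Lambda> = {vertices \<Lambda>}"
    using ne by (auto simp: connected_kgraph_def quotient_def)
  then show "\<exists>X. vertices \<Lambda> // conn_rel \<Lambda> = {X}" by blast
next
  assume "\<exists>X. vertices \<Lambda> // conn_rel \<Lambda> = {X}"
  then obtain X where X: "vertices \<Lambda> // conn_rel \<Lambda> = {X}" by blast
  then have "X = vertices \<Lambda>" using Union_quotient[OF equiv_conn_rel] by simp
  then have "conn_rel \<Lambda> `` {u} = vertices \<Lambda>" if "u \<in> vertices \<Lambda>" for u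
    using X quotientI[OF that, of "conn_rel \<Lambda>"] by simp
  moreover have "conn_rel \<Lambda> \<subseteq> vertices \<Lambda> \<times> vertices \<Lambda>"
    using equiv_conn_rel by (auto simp: equiv_def)
  ultimately show "connected_kgraph \<Lambda>"
    unfolding connected_kgraph_def by blast
qed

lemma homology_0_iso_integer_iff_one_class:
  "homology k \<Lambda> 0 \<cong> integer_group \<longleftrightarrow> (\<exists>X. vertices \<Lambda> // conn_rel \<Lambda> = {X})"
proof -
  let ?Q = "vertices \<Lambda> // conn_rel \<Lambda>"
  have Z: "integer_group \<cong> free_Abelian_group {0 :: nat}"
    by (rule isomorphic_group_integer_free_Abelian_group_singleton)
  have Z': "free_Abelian_group {0 :: nat} \<cong> integer_group"
    by (rule group.iso_sym[OF group_integer_group Z])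
  have Q: "free_Abelian_group ?Q \<cong> homology k \<Lambda> 0"
    by (rule group.iso_sym[OF homology_0_iso_free_on_classes])
  have "homology k \<Lambda> 0 \<cong> integer_group \<longleftrightarrow> free_Abelian_group ?Q \<cong> free_Abelian_group {0 :: nat}"
    using homology_0_iso_free_on_classes(2) Q Z Z' by (meson iso_trans)
  also have "\<dots> \<longleftrightarrow> (\<exists>X. ?Q = {X})"
    by (simp add: isomorphic_free_Abelian_groups eqpoll_singleton_iff)
  finally show ?thesis .
qed

end

theorem corollary3p13:
  fixes k :: nat and \<Lambda> :: "'a graded_cat" and p :: enat
  assumes "k_graph k \<Lambda>"
    and "p \<ge> 1"
    and "num_components \<Lambda> = p"
  shows "homology k \<Lambda> 0 \<cong> Zpow p
    \<and> (connected_kgraph \<Lambda> \<longleftrightarrow> homology k \<Lambda> 0 \<cong> integer_group)"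
proof -
  interpret k_graph k \<Lambda> by fact
  have "homology k \<Lambda> 0 \<cong> free_Abelian_group (vertices \<Lambda> // conn_rel \<Lambda>)"
    by (rule homology_0_iso_free_on_classes)
  also have "\<dots> \<cong> free_Abelian_group {i. enat i < p}"
    unfolding isomorphic_free_Abelian_groups assms(3)[symmetric] by (rule classes_eqpoll_index)
  also have "\<dots> \<cong> Zpow p"
    unfolding Zpow_def
    by (rule group.iso_sym[OF _ isomorphic_sum_integer_group]) simp
  finally have "homology k \<Lambda> 0 \<cong> Zpow p" .
  then show ?thesis
    by (simp add: connected_iff_one_class homology_0_iso_integer_iff_one_class)
qed

end
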